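(* Let $r\ge 0$ be an integer and let $\Delta$ be a triangulation of a region in the plane $\mathbb{R}^2$ (a finite strongly connected $2$-dimensional simplicial complex embedded in $\mathbb{R}^2$ such that the link of each simplex is strongly connected), and suppose that its dual graph $C=G_\Delta$ is a cycle; let $\alpha=\alpha_\Delta^{r+1}$ be the corresponding dual edge-labeling. Then the edge-labeled cycle $(C,\alpha)$ has at least three distinct edge-labels, unless $C$ is a four-cycle with two distinct edge-labels that alternate around the cycle.
   Context: A pure simplicial complex is strongly connected if any two of its maximal simplices can be joined by a sequence of maximal simplices in which consecutive ones share a face of codimension one. The dual graph $G_\Delta$ has one vertex $v$ for each triangle $\sigma_v$ of $\Delta$ and an edge $uv$ whenever $\sigma_u\cap\sigma_v$ is a $1$-dimensional simplex. The dual edge-labeling $\alpha_\Delta$ assigns to $uv$ the principal ideal of $\mathbb{R}[x,y]$ generated by any nonzero affine linear form vanishing on $\sigma_u\cap\sigma_v$, and $\alpha_\Delta^{r+1}$ assigns to $uv$ the ideal $\alpha_\Delta(uv)^{r+1}$. Edge-labels are compared as ideals. *)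

theory Defs
  imports
    "HOL-Analysis.Analysis"
    "HOL-Computational_Algebra.Polynomial"
    "HOL-Algebra.Ideal_Product"
    "HOL-Algebra.Algebraic_Closure_Type"
begin

section \<open>Triangulations of plane regions\<close>

text \<open>
  Simplicial complexes are the geometric ones of the library (\<^const>\<open>simplicial_complex\<close>): finite
  sets of simplices closed under taking faces. A nonempty complex contains the empty simplex, which
  has dimension \<open>-1\<close>; hence any two vertices of a \<open>0\<close>-dimensional complex share a face of
  codimension one, and the link of a maximal simplex consists of the empty simplex.
\<close>

definition maximal_simplex :: "'a::euclidean_space set set \<Rightarrow> 'a set \<Rightarrow> bool" where
  "maximal_simplex K F \<longleftrightarrow> F \<in> K \<and> \<not> (\<exists>G\<in>K. F \<subset> G)"

definition pure_complex :: "int \<Rightarrow> 'a::euclidean_space set set \<Rightarrow> bool" where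
  "pure_complex d K \<longleftrightarrow> K \<noteq> {} \<and> (\<forall>F. maximal_simplex K F \<longrightarrow> d simplex F)"

definition share_codim1_face :: "'a::euclidean_space set set \<Rightarrow> 'a set \<Rightarrow> 'a set \<Rightarrow> bool" where
  "share_codim1_face K F G \<longleftrightarrow> maximal_simplex K F \<and> maximal_simplex K G \<and>
     (\<exists>E\<in>K. E face_of F \<and> E face_of G \<and> aff_dim E = aff_dim F - 1 \<and> aff_dim E = aff_dim G - 1)"

definition strongly_connected :: "'a::euclidean_space set set \<Rightarrow> bool" where
  "strongly_connected K \<longleftrightarrow> (\<exists>d. pure_complex d K) \<and>
     (\<forall>F G. maximal_simplex K F \<longrightarrow> maximal_simplex K G \<longrightarrow> (share_codim1_face K)\<^sup>*\<^sup>* F G)"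

text \<open>
  The simplex \<open>\<sigma> \<union> \<tau>\<close> of the abstract definition of the link is geometrically the convex hull of
  the union.
\<close>

definition link :: "'a::euclidean_space set set \<Rightarrow> 'a set \<Rightarrow> 'a set set" where
  "link K \<sigma> = {\<tau>\<in>K. \<sigma> \<inter> \<tau> = {} \<and> convex hull (\<sigma> \<union> \<tau>) \<in> K}"

definition planar_triangulation :: "(real^2) set set \<Rightarrow> bool" where
  "planar_triangulation \<Delta> \<longleftrightarrow> simplicial_complex \<Delta> \<and> pure_complex 2 \<Delta> \<and>
     strongly_connected \<Delta> \<and> (\<forall>\<sigma>\<in>\<Delta>. strongly_connected (link \<Delta> \<sigma>))"


section \<open>The dual graph\<close>

definition dual_verts :: "(real^2) set set \<Rightarrow> (real^2) set set" where
  "dual_verts \<Delta> = {\<sigma>\<in>\<Delta>. 2 simplex \<sigma>}"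

definition dual_edges :: "(real^2) set set \<Rightarrow> (real^2) set set set" where
  "dual_edges \<Delta> = {{\<sigma>, \<tau>} | \<sigma> \<tau>. \<sigma> \<in> dual_verts \<Delta> \<and> \<tau> \<in> dual_verts \<Delta> \<and> 1 simplex (\<sigma> \<inter> \<tau>)}"

definition cycle_listing :: "'v set \<Rightarrow> 'v set set \<Rightarrow> 'v list \<Rightarrow> bool" where
  "cycle_listing V E vs \<longleftrightarrow> 3 \<le> length vs \<and> distinct vs \<and> set vs = V \<and>
     E = {{vs ! i, vs ! (Suc i mod length vs)} | i. i < length vs}"

definition is_cycle_graph :: "'v set \<Rightarrow> 'v set set \<Rightarrow> bool" where
  "is_cycle_graph V E \<longleftrightarrow> (\<exists>vs. cycle_listing V E vs)"

definition alternating_four_cycle :: "'v set \<Rightarrow> 'v set set \<Rightarrow> ('v set \<Rightarrow> 'l) \<Rightarrow> bool" where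
  "alternating_four_cycle V E \<alpha> \<longleftrightarrow> (\<exists>a b c d. cycle_listing V E [a, b, c, d] \<and>
     \<alpha> {a, b} = \<alpha> {c, d} \<and> \<alpha> {b, c} = \<alpha> {d, a} \<and> \<alpha> {a, b} \<noteq> \<alpha> {b, c})"


section \<open>The dual edge-labeling\<close>

text \<open>
  The type \<^typ>\<open>real poly poly\<close> represents \<open>\<real>[x,y] = \<real>[x][y]\<close>: the inner polynomials are in \<open>x\<close>,
  the outer variable is \<open>y\<close>.
\<close>

abbreviation Rxy :: "real poly poly ring" where
  "Rxy \<equiv> ring_of_type_algebra"

definition eval_at :: "real poly poly \<Rightarrow> real^2 \<Rightarrow> real" where
  "eval_at p z = poly (poly p [:z $ 2:]) (z $ 1)"

text \<open>The polynomials \<open>a x + b y + c\<close>.\<close>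

definition affine_linear_form :: "real poly poly \<Rightarrow> bool" where
  "affine_linear_form p \<longleftrightarrow> (\<exists>a b c. p = [:[:c, a:], [:b:]:])"

definition vanishing_form :: "(real^2) set \<Rightarrow> real poly poly \<Rightarrow> bool" where
  "vanishing_form S p \<longleftrightarrow> affine_linear_form p \<and> p \<noteq> 0 \<and> (\<forall>z\<in>S. eval_at p z = 0)"

text \<open>
  For a dual edge \<open>e = {\<sigma>, \<tau>}\<close> the set \<open>\<Inter>e\<close> is the common side \<open>\<sigma> \<inter> \<tau>\<close>. The choice of the form
  is immaterial; see \<open>dual_label_eq\<close> below.
\<close>

definition dual_label :: "(real^2) set set \<Rightarrow> real poly poly set" where
  "dual_label e = PIdl\<^bsub>Rxy\<^esub> (SOME p. vanishing_form (\<Inter>e) p)"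

text \<open>The exponent refers to the multiplication of ideals.\<close>

definition dual_label_pow :: "nat \<Rightarrow> (real^2) set set \<Rightarrow> real poly poly set" where
  "dual_label_pow k e = dual_label e [^]\<^bsub>ideals_set Rxy\<^esub> k"


lemma eval_at_form: "eval_at [:[:c, a:], [:b:]:] z = a * z $ 1 + b * z $ 2 + c"
  by (simp add: eval_at_def algebra_simps)

lemma PIdl_Rxy: "PIdl\<^bsub>Rxy\<^esub> p = range (\<lambda>q. q * p)"
  by (auto simp: cgenideal_def ring_of_type_algebra_def)

lemma one_simplex_two_points:
  fixes S :: "'a::euclidean_space set"
  assumes "1 simplex S"
  obtains P Q where "P \<noteq> Q" "S = closed_segment P Q"
proof -
  obtain C where C: "finite C" "int (card C) = 2" "S = convex hull C"
    using assms by (auto simp: simplex)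
  then have "card C = 2" by simp
  then obtain P Q where "C = {P, Q}" "P \<noteq> Q" by (auto simp: card_2_iff)
  with C that show thesis by (simp add: segment_convex_hull)
qed

lemma vanishing_form_exists:
  assumes "1 simplex S"
  shows "\<exists>p. vanishing_form S p"
proof -
  obtain P Q where PQ: "P \<noteq> Q" and S: "S = closed_segment P Q"
    using one_simplex_two_points[OF assms] .
  define a where "a = P $ 2 - Q $ 2"
  define b where "b = Q $ 1 - P $ 1"
  define c where "c = - (a * P $ 1 + b * P $ 2)"
  have "a \<noteq> 0 \<or> b \<noteq> 0"
    using PQ by (auto simp: a_def b_def vec_eq_iff forall_2)
  moreover have "eval_at [:[:c, a:], [:b:]:] z = 0" if "z \<in> S" for z
  proof -
    from that S obtain u where "z = (1 - u) *\<^sub>R P + u *\<^sub>R Q"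
      by (auto simp: closed_segment_def)
    then have "z $ 1 = (1 - u) * P $ 1 + u * Q $ 1" "z $ 2 = (1 - u) * P $ 2 + u * Q $ 2"
      by simp_all
    then show ?thesis
      by (simp only: eval_at_form a_def b_def c_def) (simp add: algebra_simps)
  qed
  ultimately have "vanishing_form S [:[:c, a:], [:b:]:]"
    by (auto simp: vanishing_form_def affine_linear_form_def)
  then show ?thesis by blast
qed

lemma vanishing_form_dvd:
  assumes S: "1 simplex S" and p: "vanishing_form S p" and q: "vanishing_form S q"
  shows "p dvd q"
proof -
  obtain P Q where PQ: "P \<noteq> Q" "P \<in> S" "Q \<in> S"
    using one_simplex_two_points[OF S] by (metis ends_in_segment)
  obtain a b c where p': "p = [:[:c, a:], [:b:]:]"
    using p by (auto simp: vanishing_form_def affine_linear_form_def)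
  obtain a' b' c' where q': "q = [:[:c', a':], [:b':]:]"
    using q by (auto simp: vanishing_form_def affine_linear_form_def)
  have e: "a * P $ 1 + b * P $ 2 + c = 0" "a * Q $ 1 + b * Q $ 2 + c = 0"
      "a' * P $ 1 + b' * P $ 2 + c' = 0" "a' * Q $ 1 + b' * Q $ 2 + c' = 0"
    using p q PQ(2,3) by (auto simp: vanishing_form_def p' q' eval_at_form)
  define s t where "s = P $ 1 - Q $ 1" and "t = P $ 2 - Q $ 2"
  have st: "s \<noteq> 0 \<or> t \<noteq> 0"
    using PQ(1) by (auto simp: s_def t_def vec_eq_iff forall_2)
  have l: "a * s + b * t = 0" "a' * s + b' * t = 0"
    using e by (simp_all add: s_def t_def algebra_simps)
  have "(a * b' - a' * b) * s = 0" "(a * b' - a' * b) * t = 0"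
  proof -
    have "(a * b' - a' * b) * s = b' * (a * s + b * t) - b * (a' * s + b' * t)"
      by (simp add: algebra_simps)
    then show "(a * b' - a' * b) * s = 0" using l by simp
    have "(a * b' - a' * b) * t = a * (a' * s + b' * t) - a' * (a * s + b * t)"
      by (simp add: algebra_simps)
    then show "(a * b' - a' * b) * t = 0" using l by simp
  qed
  then have det: "a * b' = a' * b"
    using st by auto
  have ab: "a \<noteq> 0 \<or> b \<noteq> 0"
  proof (rule ccontr)
    assume "\<not> ?thesis"
    then have "p = 0" using e(1) p' by simp
    then show False using p by (simp add: vanishing_form_def)
  qed
  obtain k where k: "a' = k * a" "b' = k * b"
  proof (cases "a = 0")
    case True
    then show ?thesis using ab det that[of "b' / b"] by auto
  next
    case False
    then show ?thesis using det that[of "a' / a"] by (auto simp: field_simps)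
  qed
  have "c' = k * c"
  proof -
    have "c' - k * c = (a' * P $ 1 + b' * P $ 2 + c') - k * (a * P $ 1 + b * P $ 2 + c)"
      by (simp add: k algebra_simps)
    then show ?thesis using e(1,3) by simp
  qed
  then have "q = p * [:[:k:]:]"
    by (simp add: p' q' k)
  then show ?thesis by (rule dvdI)
qed

lemma dual_label_eq:
  assumes "1 simplex (\<Inter>e)" and "vanishing_form (\<Inter>e) p"
  shows "dual_label e = PIdl\<^bsub>Rxy\<^esub> p"
proof -
  define p0 where "p0 = (SOME p. vanishing_form (\<Inter>e) p)"
  have "vanishing_form (\<Inter>e) p0"
    unfolding p0_def using assms(2) by (rule someI)
  then have "p dvd p0" "p0 dvd p"
    using assms vanishing_form_dvd by blast+
  have sub: "range (\<lambda>q. q * b) \<subseteq> range (\<lambda>q. q * a)" if "a dvd b" for a b :: "real poly poly"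
  proof -
    from that obtain k where "b = a * k" ..
    then have "q * b = (q * k) * a" for q
      by (simp add: mult_ac)
    then show ?thesis by blast
  qed
  have "range (\<lambda>q. q * p0) = range (\<lambda>q. q * p)"
    using sub[OF \<open>p dvd p0\<close>] sub[OF \<open>p0 dvd p\<close>] by blast
  then show ?thesis
    by (simp add: dual_label_def PIdl_Rxy p0_def)
qed

end

(* An edge lies on at most two triangles, so consecutive dual edges are distinct sides of one
   triangle; such sides share a vertex and span different lines, hence have different labels. If
   only two labels occur, they alternate, and all the shared vertices lie on both of the two
   corresponding lines: every interior edge starts at the one point p where the lines meet. At
   most two edges leave p along each line, so the cycle has at most four edges; a 3-cycle would
   need three labels. *)

theory Submission
  imports Defs
begin

unbundle no Formal_Power_Series.fps_syntax

section \<open>Edge labels and lines\<close>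

lemma eval_at_mult: "eval_at (p * q) z = eval_at p z * eval_at q z"
  by (simp add: eval_at_def)

lemma eval_at_power: "eval_at (p ^ k) z = eval_at p z ^ k"
  by (simp add: eval_at_def poly_power)

lemma ideal_prod_Rxy:
  "ideal_prod Rxy (range (\<lambda>q. q * a)) (range (\<lambda>q. q * b)) = range (\<lambda>q. q * (a * b))"
proof (intro equalityI subsetI)
  fix x assume "x \<in> ideal_prod Rxy (range (\<lambda>q. q * a)) (range (\<lambda>q. q * b))"
  then show "x \<in> range (\<lambda>q. q * (a * b))"
  proof (induction rule: ideal_prod.induct)
    case (prod i j)
    then obtain s t where "i = s * a" "j = t * b" by auto
    then have "i * j = (s * t) * (a * b)" by (simp add: mult_ac)
    then show ?case by (auto simp: ring_of_type_algebra_def)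
  next
    case (sum s t)
    then obtain s' t' where "s = s' * (a * b)" "t = t' * (a * b)" by auto
    then have "s + t = (s' + t') * (a * b)" by (simp add: algebra_simps)
    then show ?case by (auto simp: ring_of_type_algebra_def)
  qed
next
  fix x assume "x \<in> range (\<lambda>q. q * (a * b))"
  then obtain q where "x = (q * a) * (1 * b)" by (auto simp: mult_ac)
  then have "x = (q * a) \<otimes>\<^bsub>Rxy\<^esub> (1 * b)" by (simp add: ring_of_type_algebra_def)
  then show "x \<in> ideal_prod Rxy (range (\<lambda>q. q * a)) (range (\<lambda>q. q * b))"
    by (metis ideal_prod.prod rangeI)
qed

text \<open>Turns a power in the monoid of ideals into the concrete set of multiples of
  \<open>p ^ k\<close>, so labels can be compared by divisibility.\<close>

lemma PIdl_Rxy_pow: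
  "(PIdl\<^bsub>Rxy\<^esub> p) [^]\<^bsub>ideals_set Rxy\<^esub> (k::nat) = range (\<lambda>q. q * p ^ k)"
proof -
  interpret Rxy: cring Rxy by (rule cring_from_type_algebra)
  interpret I: comm_monoid "ideals_set Rxy" by (rule Rxy.ideals_set_is_comm_monoid)
  show ?thesis
  proof (induction k)
    case 0
    show ?case
      by (simp add: ideals_set_def) (simp add: ring_of_type_algebra_def)
  next
    case (Suc k)
    have "(PIdl\<^bsub>Rxy\<^esub> p) [^]\<^bsub>ideals_set Rxy\<^esub> Suc k
        = ideal_prod Rxy ((PIdl\<^bsub>Rxy\<^esub> p) [^]\<^bsub>ideals_set Rxy\<^esub> k) (PIdl\<^bsub>Rxy\<^esub> p)"
      by (simp add: ideals_set_def)
    also have "\<dots> = range (\<lambda>q. q * p ^ Suc k)"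
      unfolding Suc.IH unfolding PIdl_Rxy ideal_prod_Rxy power_Suc2 ..
    finally show ?case .
  qed
qed

text \<open>Equality of the ideals makes \<open>q ^ k\<close> a multiple of \<open>p ^ k\<close>, so
  a power of the value of \<open>q\<close> at \<open>z\<close> is zero. For \<open>k = 0\<close>
  both ideals would be the whole ring, whence \<open>0 < k\<close>.\<close>

lemma PIdl_Rxy_pow_eq_zeros:
  assumes "(PIdl\<^bsub>Rxy\<^esub> p) [^]\<^bsub>ideals_set Rxy\<^esub> (k::nat) = (PIdl\<^bsub>Rxy\<^esub> q) [^]\<^bsub>ideals_set Rxy\<^esub> k"
    and "0 < k" "eval_at p z = 0"
  shows "eval_at q z = 0"
proof -
  have "1 * q ^ k \<in> range (\<lambda>s. s * p ^ k)"
    using assms(1) unfolding PIdl_Rxy_pow by blast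
  then obtain s where "q ^ k = s * p ^ k" by auto
  then have "eval_at q z ^ k = eval_at s z * eval_at p z ^ k"
    by (metis eval_at_mult eval_at_power)
  then show ?thesis using assms(2,3) by (simp add: zero_power)
qed

section \<open>Zero lines of affine forms\<close>

text \<open>The vectors \<open>q - p\<close> and \<open>s - p\<close> are both orthogonal to the
  nonzero normal vector of the form, hence parallel.\<close>

lemma affine_form_zeros_collinear:
  assumes g: "affine_linear_form g" "g \<noteq> 0"
    and z: "eval_at g p = 0" "eval_at g q = 0" "eval_at g s = 0" and "p \<noteq> q"
  shows "\<exists>t. s - p = t *\<^sub>R (q - p)"
proof -
  obtain a b c where g': "g = [:[:c, a:], [:b:]:]"
    using g(1) by (auto simp: affine_linear_form_def)
  have e: "a * p $ 1 + b * p $ 2 + c = 0" "a * q $ 1 + b * q $ 2 + c = 0"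
      "a * s $ 1 + b * s $ 2 + c = 0"
    using z by (simp_all add: g' eval_at_form)
  have ab: "a \<noteq> 0 \<or> b \<noteq> 0"
    using e(1) g(2) by (auto simp: g')
  define u where "u = q - p"
  define v where "v = s - p"
  have l: "a * u $ 1 + b * u $ 2 = 0" "a * v $ 1 + b * v $ 2 = 0"
    using e by (simp_all add: u_def v_def algebra_simps)
  \<comment> \<open>The determinant of \<open>u\<close> and \<open>v\<close> is killed by both
    \<open>a\<close> and \<open>b\<close>, one of which is nonzero.\<close>
  have "a * (u $ 1 * v $ 2 - u $ 2 * v $ 1) = 0" "b * (u $ 1 * v $ 2 - u $ 2 * v $ 1) = 0"
  proof -
    have "a * (u $ 1 * v $ 2 - u $ 2 * v $ 1)
        = v $ 2 * (a * u $ 1 + b * u $ 2) - u $ 2 * (a * v $ 1 + b * v $ 2)"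
      by (simp add: algebra_simps)
    then show "a * (u $ 1 * v $ 2 - u $ 2 * v $ 1) = 0" using l by simp
    have "b * (u $ 1 * v $ 2 - u $ 2 * v $ 1)
        = u $ 1 * (a * v $ 1 + b * v $ 2) - v $ 1 * (a * u $ 1 + b * u $ 2)"
      by (simp add: algebra_simps)
    then show "b * (u $ 1 * v $ 2 - u $ 2 * v $ 1) = 0" using l by simp
  qed
  then have d: "u $ 1 * v $ 2 = u $ 2 * v $ 1"
    using ab by auto
  have u: "u $ 1 \<noteq> 0 \<or> u $ 2 \<noteq> 0"
    using \<open>p \<noteq> q\<close> by (auto simp: u_def vec_eq_iff forall_2)
  have "\<exists>t. v = t *\<^sub>R u"
  proof (cases "u $ 1 = 0")
    case True
    then show ?thesis using u d
      by (intro exI[of _ "v $ 2 / u $ 2"]) (auto simp: vec_eq_iff forall_2)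
  next
    case False
    then show ?thesis using d
      by (intro exI[of _ "v $ 1 / u $ 1"]) (auto simp: vec_eq_iff forall_2 field_simps)
  qed
  then show ?thesis by (simp add: u_def v_def)
qed

text \<open>Names the choice made inside \<open>dual_label\<close>, so that labels can be studied
  through the zeros of one fixed form.\<close>

definition edge_form :: "(real^2) set set \<Rightarrow> real poly poly" where
  "edge_form e = (SOME p. vanishing_form (\<Inter>e) p)"

lemma vanishing_edge_form:
  assumes "1 simplex (\<Inter>e)"
  shows "vanishing_form (\<Inter>e) (edge_form e)"
  unfolding edge_form_def using vanishing_form_exists[OF assms] by (rule someI_ex)

lemma dual_label_edge_form: "dual_label e = PIdl\<^bsub>Rxy\<^esub> (edge_form e)"
  by (simp add: dual_label_def edge_form_def)

lemma dual_label_pow_eq_zeros: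
  assumes "dual_label_pow k e = dual_label_pow k f" "0 < k" "eval_at (edge_form e) z = 0"
  shows "eval_at (edge_form f) z = 0"
  using assms unfolding dual_label_pow_def dual_label_edge_form by (rule PIdl_Rxy_pow_eq_zeros)

text \<open>Two distinct common zeros force both forms to define the same line. So the form of
  \<open>f\<close> also vanishes on the side of \<open>e\<close>, and by
  \<open>dual_label_eq\<close> it generates the label of \<open>e\<close> as well.\<close>

lemma dual_label_pow_eq_if_two_zeros:
  assumes ef: "1 simplex (\<Inter>e)" "1 simplex (\<Inter>f)" and "p \<noteq> q"
    and z: "eval_at (edge_form e) p = 0" "eval_at (edge_form e) q = 0"
      "eval_at (edge_form f) p = 0" "eval_at (edge_form f) q = 0"
  shows "dual_label_pow k e = dual_label_pow k f"
proof -
  have form: "affine_linear_form (edge_form e)" "edge_form e \<noteq> 0"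
      "affine_linear_form (edge_form f)" "edge_form f \<noteq> 0"
    using ef[THEN vanishing_edge_form] by (auto simp: vanishing_form_def)
  have "eval_at (edge_form f) w = 0" if "w \<in> \<Inter>e" for w
  proof -
    have "eval_at (edge_form e) w = 0"
      using vanishing_edge_form[OF ef(1)] that by (auto simp: vanishing_form_def)
    then obtain t where t: "w - p = t *\<^sub>R (q - p)"
      using affine_form_zeros_collinear form z \<open>p \<noteq> q\<close> by blast
    obtain a b c where g: "edge_form f = [:[:c, a:], [:b:]:]"
      using form by (auto simp: affine_linear_form_def)
    have w: "w $ i = p $ i + t * (q $ i - p $ i)" for i
      using arg_cong[OF t, of "\<lambda>x. x $ i"] by simp
    \<comment> \<open>An affine form interpolates linearly along the line through \<open>p\<close>
      and \<open>q\<close>.\<close>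
    have "eval_at (edge_form f) w
        = (1 - t) * eval_at (edge_form f) p + t * eval_at (edge_form f) q"
      unfolding g eval_at_form w by (simp add: algebra_simps)
    then show ?thesis using z(3,4) by simp
  qed
  then have "vanishing_form (\<Inter>e) (edge_form f)"
    using form by (simp add: vanishing_form_def)
  then have "dual_label e = dual_label f"
    using dual_label_eq[OF ef(1)] by (simp add: dual_label_edge_form)
  then show ?thesis by (simp add: dual_label_pow_def)
qed


section \<open>Edges and triangles in a plane complex\<close>

lemma simplicial_complex_face:
  assumes "simplicial_complex K" "S \<in> K" "T \<in> K" "T \<subseteq> S"
  shows "T face_of S"
proof -
  have "S \<inter> T face_of S" using assms(1-3) unfolding simplicial_complex_def by blast
  then show ?thesis using assms(4) by (simp add: Int_absorb1)
qed

lemma simplicial_complex_subset_eq: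
  assumes "simplicial_complex K" "S \<in> K" "T \<in> K" "T \<subseteq> S" "n simplex S" "n simplex T"
  shows "T = S"
proof (rule ccontr)
  assume "T \<noteq> S"
  then have "aff_dim T < aff_dim S"
    using simplicial_complex_face[OF assms(1-4)] convex_simplex[OF assms(5)]
    by (intro face_of_aff_dim_lt)
  then show False using assms(5,6) by (simp add: aff_dim_simplex)
qed

text \<open>A face that meets the relative interior of a simplex is the whole simplex; this applies
  to \<open>S \<inter> T\<close> in both \<open>S\<close> and \<open>T\<close>.\<close>

lemma simplicial_complex_interior_eq:
  assumes K: "simplicial_complex K" "S \<in> K" "T \<in> K" and "interior S \<inter> interior T \<noteq> {}"
  shows "S = T"
proof -
  have S: "S \<inter> T face_of S" and T: "S \<inter> T face_of T"
    using K unfolding simplicial_complex_def by (metis Int_commute)+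
  obtain x where "x \<in> interior S" "x \<in> interior T"
    using assms(4) by blast
  then have "x \<in> S \<inter> T" "x \<in> rel_interior S" "x \<in> rel_interior T"
    using interior_subset interior_subset_rel_interior by blast+
  then have "S \<inter> T = S" "S \<inter> T = T"
    using S T face_of_disjoint_rel_interior by blast+
  then show ?thesis by simp
qed

section \<open>Sides of a triangle\<close>

text \<open>Faces of the hull of an affinely independent set are hulls of subsets. Dimension one
  leaves two of the three vertices, and the third is the apex \<open>a\<close>.\<close>

lemma edge_of_triangleE:
  fixes T :: "'a::euclidean_space set"
  assumes "2 simplex T" "1 simplex e" "e face_of T"
  obtains P Q a where "P \<noteq> Q" "e = closed_segment P Q" "T = convex hull {P, Q, a}"
    "\<not> collinear {P, Q, a}"
proof -
  obtain C where C: "\<not> affine_dependent C" "card C = 3" "T = convex hull C"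
    using assms(1) by (auto simp: simplex_def)
  obtain D where D: "D \<subseteq> C" "e = convex hull D"
    using assms(3) C face_of_convex_hull_affine_independent by blast
  have indD: "\<not> affine_dependent D"
    using C(1) D(1) affine_independent_subset by blast
  have "int (card D) = 2"
    using aff_dim_simplex[OF assms(2)] aff_dim_affine_independent[OF indD] D(2)
    by (simp add: aff_dim_convex_hull)
  then have cD: "card D = 2" by simp
  then obtain P Q where PQ: "D = {P, Q}" "P \<noteq> Q" by (auto simp: card_2_iff)
  have "card (C - D) = 1"
    using C(2) D(1) cD by (simp add: card_Diff_subset card_ge_0_finite)
  then obtain a where a: "C - D = {a}" by (auto simp: card_1_singleton_iff)
  then have Ceq: "C = {P, Q, a}" "a \<noteq> P" "a \<noteq> Q" using D(1) PQ by auto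
  then have "\<not> collinear {P, Q, a}"
    using C(1) PQ(2) by (auto simp: collinear_3_eq_affine_dependent)
  then show thesis
    using that[of P Q a] PQ D(2) C(3) Ceq by (simp add: segment_convex_hull)
qed

lemma two_edges_of_triangleE:
  fixes T :: "'a::euclidean_space set"
  assumes T: "2 simplex T" and e: "1 simplex e" "e face_of T" and f: "1 simplex f" "f face_of T"
    and "e \<noteq> f"
  obtains p q s where "e = closed_segment p q" "f = closed_segment p s" "\<not> collinear {p, q, s}"
proof -
  obtain P Q a where e': "P \<noteq> Q" "e = closed_segment P Q" "T = convex hull {P, Q, a}"
      and nc: "\<not> collinear {P, Q, a}"
    using edge_of_triangleE[OF T e] .
  have ind: "\<not> affine_dependent {P, Q, a}"
    using nc by (auto simp: collinear_3_eq_affine_dependent)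
  obtain D where D: "D \<subseteq> {P, Q, a}" "f = convex hull D"
    using f(2) e'(3) ind face_of_convex_hull_affine_independent by blast
  have indD: "\<not> affine_dependent D"
    using ind D(1) affine_independent_subset by blast
  have "int (card D) = 2"
    using aff_dim_simplex[OF f(1)] aff_dim_affine_independent[OF indD] D(2)
    by (simp add: aff_dim_convex_hull)
  then have "card D = 2" by simp
  then obtain x y where xy: "D = {x, y}" "x \<noteq> y" by (auto simp: card_2_iff)
  \<comment> \<open>A second side must contain the apex \<open>a\<close>, hence shares exactly one
    of \<open>P\<close> and \<open>Q\<close> with the first.\<close>
  have "D \<noteq> {P, Q}"
    using D(2) e'(2) \<open>e \<noteq> f\<close> by (auto simp: segment_convex_hull)
  then consider "D = {P, a}" | "D = {Q, a}"
    using D(1) xy by auto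
  then show thesis
  proof cases
    case 1
    then show thesis using that[of P Q a] e' D nc by (simp add: segment_convex_hull)
  next
    case 2
    then show thesis using that[of Q P a] e' D nc
      by (simp add: segment_convex_hull insert_commute)
  qed
qed

section \<open>Triangles on the two sides of an edge\<close>

text \<open>Twice the signed area of the triangle \<open>P Q z\<close>; its sign tells the side of the line \<open>P Q\<close>.\<close>

definition signed_area :: "real^2 \<Rightarrow> real^2 \<Rightarrow> real^2 \<Rightarrow> real" where
  "signed_area P Q z = (Q $ 1 - P $ 1) * (z $ 2 - P $ 2) - (Q $ 2 - P $ 2) * (z $ 1 - P $ 1)"

text \<open>Barycentric coordinates. The signed area is affine in its last argument and vanishes at
  \<open>P\<close> and \<open>Q\<close>, so only the weight of \<open>b\<close> survives.\<close>

lemma affine_coordinates: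
  assumes "\<not> collinear {P, Q, b :: real^2}"
  obtains u v w where "u + v + w = 1" "a = u *\<^sub>R P + v *\<^sub>R Q + w *\<^sub>R b"
    "signed_area P Q a = w * signed_area P Q b"
proof -
  have "\<not> affine_dependent {P, Q, b}" "card {P, Q, b} = 3"
    using assms by (auto simp: collinear_3_eq_affine_dependent)
  then have "aff_dim {P, Q, b} = DIM(real^2)"
    using aff_dim_affine_independent[of "{P, Q, b}"] by simp
  then have "affine hull {P, Q, b} = UNIV"
    by (simp only: aff_dim_eq_full)
  then obtain u v w where uvw: "u + v + w = 1" and a: "a = u *\<^sub>R P + v *\<^sub>R Q + w *\<^sub>R b"
    unfolding affine_hull_3 by blast
  have "u = 1 - v - w" using uvw by simp
  then have ai: "a $ i = (1 - v - w) * P $ i + v * Q $ i + w * b $ i" for i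
    by (simp add: a)
  have "signed_area P Q a = w * signed_area P Q b"
    unfolding signed_area_def ai by (simp add: algebra_simps)
  then show thesis using that uvw a by blast
qed

lemma signed_area_nonzero:
  assumes "\<not> collinear {P, Q, a}"
  shows "signed_area P Q a \<noteq> 0"
proof
  \<comment> \<open>\<open>c - P\<close> is \<open>Q - P\<close> turned by a right angle, so the
    area at \<open>c\<close> is the squared length of \<open>P Q\<close>. But zero area at
    \<open>a\<close> would force zero area everywhere.\<close>
  define c where "c = P + vector [P $ 2 - Q $ 2, Q $ 1 - P $ 1]"
  assume a: "signed_area P Q a = 0"
  obtain w where "signed_area P Q c = w * signed_area P Q a"
    using affine_coordinates[OF assms] by blast
  then have "signed_area P Q c = 0" using a by simp
  moreover have "signed_area P Q c = (Q $ 1 - P $ 1)\<^sup>2 + (Q $ 2 - P $ 2)\<^sup>2"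
    by (simp add: signed_area_def c_def power2_eq_square algebra_simps)
  ultimately have "(Q $ 1 - P $ 1)\<^sup>2 + (Q $ 2 - P $ 2)\<^sup>2 = 0" by simp
  then have "P = Q"
    by (simp add: vec_eq_iff forall_2)
  then show False using assms by simp
qed

lemma interior_triangleI:
  fixes P Q a :: "real^2"
  assumes "\<not> collinear {P, Q, a}" "0 < x" "0 < y" "0 < z" "x + y + z = 1"
  shows "x *\<^sub>R P + y *\<^sub>R Q + z *\<^sub>R a \<in> interior (convex hull {P, Q, a})"
  using assms by (subst interior_convex_hull_3_minimal) auto

text \<open>A point slightly off the midpoint of \<open>P Q\<close> lies in both interiors.\<close>

lemma same_side_triangles_overlap:
  fixes P Q a b :: "real^2"
  assumes nc: "\<not> collinear {P, Q, a}" "\<not> collinear {P, Q, b}"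
    and s: "0 < signed_area P Q a * signed_area P Q b"
  shows "interior (convex hull {P, Q, a}) \<inter> interior (convex hull {P, Q, b}) \<noteq> {}"
proof -
  obtain u v w where uvw: "u + v + w = 1" "a = u *\<^sub>R P + v *\<^sub>R Q + w *\<^sub>R b"
      and area: "signed_area P Q a = w * signed_area P Q b"
    using affine_coordinates[OF nc(2)] by blast
  have w: "0 < w"
  proof -
    \<comment> \<open>The product of the two areas is \<open>w\<close> times a square.\<close>
    have "0 < w * (signed_area P Q b)\<^sup>2"
      using s area by (simp add: power2_eq_square mult_ac)
    then show ?thesis by (simp add: zero_less_mult_iff)
  qed
  \<comment> \<open>Small enough that adding \<open>t * u\<close> or \<open>t * v\<close> to
    \<open>(1 - t) / 2\<close> keeps it positive, since each is at most 1/4 in absolute value while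
    \<open>(1 - t) / 2\<close> is at least 3/8.\<close>
  define t where "t = 1 / (4 * (1 + \<bar>u\<bar> + \<bar>v\<bar>))"
  have "0 < 1 + \<bar>u\<bar> + \<bar>v\<bar>" by simp
  then have t: "0 < t" and "t * (1 + \<bar>u\<bar> + \<bar>v\<bar>) = 1/4"
    by (simp_all add: t_def)
  then have "t + t * \<bar>u\<bar> + t * \<bar>v\<bar> = 1/4"
    by (simp add: distrib_left)
  moreover have "0 \<le> t * \<bar>u\<bar>" "0 \<le> t * \<bar>v\<bar>" using t by simp_all
  moreover have "- (t * \<bar>u\<bar>) \<le> t * u" "- (t * \<bar>v\<bar>) \<le> t * v"
    using t mult_left_mono[of "- \<bar>u\<bar>" u t] mult_left_mono[of "- \<bar>v\<bar>" v t] by auto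
  ultimately have pos: "0 < (1 - t) / 2" "0 < (1 - t) / 2 + t * u" "0 < (1 - t) / 2 + t * v"
    using t by argo+
  define m where "m = ((1 - t) / 2) *\<^sub>R P + ((1 - t) / 2) *\<^sub>R Q + t *\<^sub>R a"
  have "m \<in> interior (convex hull {P, Q, a})"
    unfolding m_def using pos t by (intro interior_triangleI nc) auto
  \<comment> \<open>Substituting the coordinates of \<open>a\<close> expresses \<open>m\<close> in
    terms of \<open>P\<close>, \<open>Q\<close> and \<open>b\<close>.\<close>
  moreover have "m = ((1 - t) / 2 + t * u) *\<^sub>R P + ((1 - t) / 2 + t * v) *\<^sub>R Q + (t * w) *\<^sub>R b"
    by (simp add: m_def uvw(2) algebra_simps)
  moreover have "(1 - t) / 2 + t * u + ((1 - t) / 2 + t * v) + t * w = 1 - t + t * (u + v + w)"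
    unfolding distrib_left by simp
  ultimately have "m \<in> interior (convex hull {P, Q, b})"
    using interior_triangleI[OF nc(2) pos(2,3), of "t * w"] t w uvw(1) by simp
  with \<open>m \<in> interior (convex hull {P, Q, a})\<close> show ?thesis by blast
qed

lemma triangle_at_edgeE:
  fixes T :: "'a::euclidean_space set"
  assumes T: "2 simplex T" and PQ: "P \<noteq> Q" and e: "closed_segment P Q face_of T"
  obtains a where "T = convex hull {P, Q, a}" "\<not> collinear {P, Q, a}"
proof -
  obtain P' Q' a where "closed_segment P Q = closed_segment P' Q'"
      and a: "T = convex hull {P', Q', a}" "\<not> collinear {P', Q', a}"
    using edge_of_triangleE[OF T one_simplex_segment[OF PQ] e] .
  then have "{P, Q} = {P', Q'}" by simp
  then have "{P', Q', a} = {P, Q, a}" by blast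
  then show thesis using that a by simp
qed

text \<open>An edge has only two sides: of three triangles on it, two have their apex on the same
  side, so their interiors overlap and they coincide.\<close>

lemma triangle_has_two_sides:
  fixes \<Delta> :: "(real^2) set set"
  assumes \<Delta>: "simplicial_complex \<Delta>"
    and ABC: "A \<in> \<Delta>" "B \<in> \<Delta>" "C \<in> \<Delta>" "2 simplex A" "2 simplex B" "2 simplex C"
    and e: "e \<in> \<Delta>" "1 simplex e" "e \<subseteq> A" "e \<subseteq> B" "e \<subseteq> C"
  shows "A = B \<or> A = C \<or> B = C"
proof -
  obtain P Q where PQ: "P \<noteq> Q" "e = closed_segment P Q"
    using one_simplex_two_points[OF e(2)] .
  have apex: "\<exists>a. T = convex hull {P, Q, a} \<and> \<not> collinear {P, Q, a}"
    if "T \<in> \<Delta>" "2 simplex T" "e \<subseteq> T" for T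
    using triangle_at_edgeE[OF that(2) PQ(1)] simplicial_complex_face[OF \<Delta> that(1) e(1) that(3)]
    unfolding PQ(2) by metis
  obtain a b c where abc: "A = convex hull {P, Q, a}" "B = convex hull {P, Q, b}"
      "C = convex hull {P, Q, c}" and nc: "\<not> collinear {P, Q, a}" "\<not> collinear {P, Q, b}"
      "\<not> collinear {P, Q, c}"
    using apex ABC e by metis
  \<comment> \<open>Of three nonzero reals, two have the same sign.\<close>
  have "0 < signed_area P Q a * signed_area P Q b \<or> 0 < signed_area P Q a * signed_area P Q c
      \<or> 0 < signed_area P Q b * signed_area P Q c"
    using nc[THEN signed_area_nonzero] by (auto simp: zero_less_mult_iff)
  then show ?thesis
    using same_side_triangles_overlap nc simplicial_complex_interior_eq[OF \<Delta>] ABC abc by metis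
qed

section \<open>Edges leaving a common vertex\<close>

text \<open>On a common ray the shorter segment lies in the longer one, and a simplex of the complex
  contains no other of the same dimension.\<close>

lemma edges_on_same_ray_eq:
  fixes K :: "'a::euclidean_space set set"
  assumes K: "simplicial_complex K" "closed_segment p q \<in> K" "closed_segment p s \<in> K"
    and ne: "p \<noteq> q" and t: "s - p = t *\<^sub>R (q - p)" "0 < t"
  shows "closed_segment p q = closed_segment p s"
proof -
  have sub: "closed_segment p s' \<subseteq> closed_segment p q'"
    if "s' - p = t' *\<^sub>R (q' - p)" "0 < t'" "t' \<le> 1" for s' q' :: 'a and t'
  proof -
    have "s' = (1 - t') *\<^sub>R p + t' *\<^sub>R q'"
      using that(1) by (simp add: algebra_simps)
    then have "s' \<in> closed_segment p q'"
      using that(2,3) by (auto simp: closed_segment_def)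
    then show ?thesis by (simp add: subset_closed_segment)
  qed
  have ps: "p \<noteq> s" using t ne by auto
  have simplex: "1 simplex closed_segment p q" "1 simplex closed_segment p s"
    using ne ps one_simplex_segment by blast+
  show ?thesis
  proof (cases "t \<le> 1")
    case True
    then have "closed_segment p s \<subseteq> closed_segment p q" using sub t by blast
    then show ?thesis using simplicial_complex_subset_eq K simplex by metis
  next
    case False
    then have "q - p = inverse t *\<^sub>R (s - p)" "0 < inverse t" "inverse t \<le> 1"
      using t by (simp_all add: inverse_le_1_iff)
    then have "closed_segment p q \<subseteq> closed_segment p s" using sub by blast
    then show ?thesis using simplicial_complex_subset_eq K simplex by metis
  qed
qed

text \<open>Of three edges leaving \<open>p\<close> along one line, two leave in the same direction.\<close>

lemma collinear_edges_at_vertex: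
  fixes \<Delta> :: "(real^2) set set"
  assumes \<Delta>: "simplicial_complex \<Delta>"
    and e: "closed_segment p a \<in> \<Delta>" "closed_segment p b \<in> \<Delta>" "closed_segment p c \<in> \<Delta>"
    and ne: "p \<noteq> a" "p \<noteq> b" "p \<noteq> c"
    and g: "affine_linear_form g" "g \<noteq> 0" "eval_at g p = 0"
      "eval_at g a = 0" "eval_at g b = 0" "eval_at g c = 0"
  shows "closed_segment p a = closed_segment p b \<or> closed_segment p a = closed_segment p c \<or>
    closed_segment p b = closed_segment p c"
proof -
  obtain t where t: "b - p = t *\<^sub>R (a - p)"
    using affine_form_zeros_collinear g ne(1) by blast
  obtain u where u: "c - p = u *\<^sub>R (a - p)"
    using affine_form_zeros_collinear g ne(1) by blast
  have nz: "t \<noteq> 0" "u \<noteq> 0" using t u ne by auto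
  have bc: "c - p = (u / t) *\<^sub>R (b - p)" using t u nz by simp
  \<comment> \<open>If \<open>t\<close> and \<open>u\<close> are both negative, their quotient is
    positive: \<open>b\<close> and \<open>c\<close> then lie on the same ray.\<close>
  have "0 < t \<or> 0 < u \<or> 0 < u / t"
    using nz by (auto simp: zero_less_divide_iff)
  then show ?thesis
    using edges_on_same_ray_eq[OF \<Delta>] e ne t u bc by metis
qed

section \<open>Labels of two sides of one triangle\<close>

text \<open>With equal labels, the form of one side would vanish at all three vertices, making them
  collinear.\<close>

lemma dual_label_pow_neq_in_triangle:
  fixes T :: "(real^2) set"
  assumes T: "2 simplex T" and e: "1 simplex (\<Inter>e)" "\<Inter>e face_of T"
    and f: "1 simplex (\<Inter>f)" "\<Inter>f face_of T" and "\<Inter>e \<noteq> \<Inter>f" "0 < k"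
  shows "dual_label_pow k e \<noteq> dual_label_pow k f"
proof
  assume eq: "dual_label_pow k e = dual_label_pow k f"
  obtain p q s where pqs: "\<Inter>e = closed_segment p q" "\<Inter>f = closed_segment p s"
      "\<not> collinear {p, q, s}"
    using two_edges_of_triangleE[OF T e f \<open>\<Inter>e \<noteq> \<Inter>f\<close>] .
  have form: "vanishing_form (\<Inter>e) (edge_form e)" "vanishing_form (\<Inter>f) (edge_form f)"
    using vanishing_edge_form e f by blast+
  have "eval_at (edge_form f) s = 0"
    using form(2) pqs(2) by (auto simp: vanishing_form_def)
  then have "eval_at (edge_form e) s = 0"
    using dual_label_pow_eq_zeros[OF eq[symmetric] \<open>0 < k\<close>] by blast
  moreover have "eval_at (edge_form e) p = 0" "eval_at (edge_form e) q = 0"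
    using form(1) pqs(1) by (auto simp: vanishing_form_def)
  moreover have "p \<noteq> q" using pqs(3) by auto
  ultimately obtain t where "s - p = t *\<^sub>R (q - p)"
    using affine_form_zeros_collinear form(1) unfolding vanishing_form_def by blast
  then have "s = (1 - t) *\<^sub>R p + t *\<^sub>R q" by (simp add: algebra_simps)
  then have "s \<in> affine hull {p, q}" unfolding affine_hull_2 by force
  then show False using pqs(3) affine_hull_3_imp_collinear by blast
qed

section \<open>Cycles of triangles\<close>

lemma card_image_less_3:
  assumes "finite S" "\<not> 3 \<le> card S" "a \<in> S" "b \<in> S" "c \<in> S"
  shows "a = b \<or> a = c \<or> b = c"
proof (rule ccontr)
  assume "\<not> ?thesis"
  then have "card {a, b, c} = 3" by simp
  moreover have "card {a, b, c} \<le> card S"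
    using assms by (intro card_mono) auto
  ultimately show False using assms(2) by simp
qed

theorem lemma6p13:
  fixes r :: nat and \<Delta> :: "(real^2) set set"
  assumes "planar_triangulation \<Delta>"
    and "is_cycle_graph (dual_verts \<Delta>) (dual_edges \<Delta>)"
  shows "3 \<le> card (dual_label_pow (r + 1) ` dual_edges \<Delta>) \<or>
         alternating_four_cycle (dual_verts \<Delta>) (dual_edges \<Delta>) (dual_label_pow (r + 1))"
  unfolding disj_imp
proof
  assume few: "\<not> 3 \<le> card (dual_label_pow (r + 1) ` dual_edges \<Delta>)"
  have \<Delta>: "simplicial_complex \<Delta>"
    using assms(1) by (simp add: planar_triangulation_def)
  obtain vs where vs: "cycle_listing (dual_verts \<Delta>) (dual_edges \<Delta>) vs"
    using assms(2) by (auto simp: is_cycle_graph_def)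
  define n where "n = length vs"
  \<comment> \<open>Indices are reduced modulo \<open>n\<close>, so that \<open>edge i\<close> and
    \<open>edge (Suc i)\<close> are consecutive for every natural number \<open>i\<close>, with no
    special case at the end of the list.\<close>
  define T where "T i = vs ! (i mod n)" for i
  define edge where "edge i = {T i, T (Suc i)}" for i
  define L where "L i = dual_label_pow (r + 1) (edge i)" for i
  have n: "3 \<le> n" and dist: "distinct vs" and verts: "set vs = dual_verts \<Delta>"
      and edges: "dual_edges \<Delta> = {{vs ! i, vs ! (Suc i mod n)} | i. i < n}"
    using vs by (auto simp: cycle_listing_def n_def)
  have T_eq: "T i = T j \<longleftrightarrow> i mod n = j mod n" for i j
  proof -
    have "k mod n < length vs" for k using n by (simp add: n_def[symmetric])
    then show ?thesis unfolding T_def using dist by (simp add: nth_eq_iff_index_eq)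
  qed
  have T_shift: "T (i + d) \<noteq> T i" if "0 < d" "d < n" for d i
  proof
    assume "T (i + d) = T i"
    then have "n dvd i + d - i" by (simp only: T_eq mod_eq_dvd_iff_nat le_add1)
    then show False using that by (auto dest: dvd_imp_le)
  qed
  have T_in: "T i \<in> \<Delta>" "2 simplex T i" for i
  proof -
    have "T i \<in> dual_verts \<Delta>"
      unfolding verts[symmetric] T_def using n by (intro nth_mem) (simp add: n_def[symmetric])
    then show "T i \<in> \<Delta>" "2 simplex T i" by (simp_all add: dual_verts_def)
  qed
  have edge_in: "edge i \<in> dual_edges \<Delta>" for i
  proof -
    have "edge i = {vs ! (i mod n), vs ! (Suc (i mod n) mod n)}"
      by (simp add: edge_def T_def mod_Suc_eq)
    moreover have "i mod n < n" using n by simp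
    ultimately show ?thesis unfolding edges by blast
  qed
  have I_edge: "\<Inter>(edge i) = T i \<inter> T (Suc i)" for i
    by (simp add: edge_def)
  have simplex: "1 simplex (\<Inter>(edge i))" for i
  proof -
    obtain \<sigma> \<tau> where "edge i = {\<sigma>, \<tau>}" "1 simplex (\<sigma> \<inter> \<tau>)"
      using edge_in[of i] by (auto simp: dual_edges_def)
    then show ?thesis by simp
  qed
  have face: "\<Inter>(edge i) face_of T i" "\<Inter>(edge i) face_of T (Suc i)" for i
    using \<Delta> T_in[of i] T_in[of "Suc i"] unfolding I_edge simplicial_complex_def
    by (blast, metis Int_commute)
  have E_in: "\<Inter>(edge i) \<in> \<Delta>" for i
    using \<Delta> T_in face unfolding simplicial_complex_def by blast
  \<comment> \<open>Otherwise \<open>T j\<close> would be a third triangle on the side shared by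
    \<open>T i\<close> and \<open>T (Suc i)\<close>.\<close>
  have edges_neq: "\<Inter>(edge i) \<noteq> \<Inter>(edge j)"
    if "T i \<noteq> T j" "T (Suc i) \<noteq> T j" for i j
  proof
    assume eq: "\<Inter>(edge i) = \<Inter>(edge j)"
    have "\<Inter>(edge i) \<subseteq> T i" "\<Inter>(edge i) \<subseteq> T (Suc i)"
      by (auto simp: I_edge)
    moreover have "\<Inter>(edge i) \<subseteq> T j"
      unfolding eq by (auto simp: I_edge)
    moreover have "T i \<noteq> T (Suc i)"
      using T_shift[of 1 i] n by auto
    ultimately show False
      using triangle_has_two_sides[OF \<Delta>, of "T i" "T (Suc i)" "T j" "\<Inter>(edge i)"]
        T_in E_in simplex that by auto
  qed
  \<comment> \<open>The triangle \<open>T i\<close> differs from \<open>T (Suc i)\<close> and from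
    \<open>T (i + 2)\<close> because \<open>n\<close> is at least 3.\<close>
  have adjacent: "\<Inter>(edge i) \<noteq> \<Inter>(edge (Suc i))" for i
    using edges_neq[of "Suc i" i] T_shift[of 1 i] T_shift[of 2 i] n by auto
  have L_neq: "L i \<noteq> L (Suc i)" for i
    unfolding L_def
    by (rule dual_label_pow_neq_in_triangle[of "T (Suc i)"]) (use T_in simplex face adjacent in auto)
  have "finite (dual_edges \<Delta>)"
    unfolding edges by simp
  then have two_labels: "L i = L j \<or> L i = L k \<or> L j = L k" for i j k
    using card_image_less_3[OF _ few, of "L i" "L j" "L k"] edge_in by (simp add: L_def)
  \<comment> \<open>Among three consecutive labels two agree, and neighbours differ, so the outer
    two agree.\<close>
  have L_alt: "L (Suc (Suc i)) = L i" for i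
    using two_labels[of i "Suc i" "Suc (Suc i)"] L_neq[of i] L_neq[of "Suc i"] by auto
  have L_n: "L n = L 0"
    using n by (simp add: L_def edge_def T_def mod_Suc)
  consider "n = 3" | "n = 4" | "5 \<le> n" using n by linarith
  then show "alternating_four_cycle (dual_verts \<Delta>) (dual_edges \<Delta>) (dual_label_pow (r + 1))"
  proof cases
    case 1
    \<comment> \<open>Contradiction: alternation gives \<open>L 3 = L 1\<close>, going once around
      gives \<open>L 3 = L 0\<close>.\<close>
    then show ?thesis
      using L_n L_alt[of 1] L_neq[of 0] by (simp add: numeral_3_eq_3)
  next
    case 2
    then obtain a b c d where abcd: "vs = [a, b, c, d]"
      unfolding n_def by (auto simp: length_Suc_conv numeral_eq_Suc)
    have "T 0 = a" "T 1 = b" "T 2 = c" "T 3 = d" "T 4 = a"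
      by (simp_all add: T_def 2) (simp_all add: abcd)
    then have "edge 0 = {a, b}" "edge 1 = {b, c}" "edge 2 = {c, d}" "edge 3 = {d, a}"
      by (simp_all add: edge_def eval_nat_numeral)
    moreover have "L 2 = L 0" "L 3 = L 1" "L 0 \<noteq> L 1"
      using L_alt[of 0] L_alt[of 1] L_neq[of 0] by (simp_all add: eval_nat_numeral)
    ultimately show ?thesis
      using vs unfolding alternating_four_cycle_def abcd L_def by metis
  next
    case 3
    have form: "vanishing_form (\<Inter>(edge i)) (edge_form (edge i))" for i
      using vanishing_edge_form simplex by blast
    \<comment> \<open>Both sides belong to \<open>T (Suc i)\<close>; \<open>p i\<close> becomes the
      vertex that they share.\<close>
    have "\<exists>p q s. \<Inter>(edge i) = closed_segment p q \<and> \<Inter>(edge (Suc i)) = closed_segment p s" for i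
      using two_edges_of_triangleE[OF T_in(2) simplex face(2) simplex face(1) adjacent] by metis
    then obtain p q s where
      pq: "\<And>i. \<Inter>(edge i) = closed_segment (p i) (q i)"
      and ps: "\<And>i. \<Inter>(edge (Suc i)) = closed_segment (p i) (s i)" by metis
    have zero: "eval_at (edge_form (edge i)) z = 0"
      if "z \<in> \<Inter>(edge j)" "L j = L i" for i j z
      using dual_label_pow_eq_zeros[of "r + 1" "edge j" "edge i"] form[of j] that
      by (auto simp: L_def vanishing_form_def)
    have L02: "L 2 = L 0" "L 4 = L 0" "L 3 = L 1"
      using L_alt[of 0] L_alt[of 1] L_alt[of 2] by (simp_all add: numeral_eq_Suc)
    \<comment> \<open>\<open>p 0\<close> lies on the lines of both labels; a second such point would
      make the two labels equal.\<close>
    have common: "z = p 0"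
      if "z \<in> \<Inter>(edge i)" "L i = L 0" "z \<in> \<Inter>(edge j)" "L j = L 1" for z i j
    proof (rule ccontr)
      assume "z \<noteq> p 0"
      moreover have "p 0 \<in> \<Inter>(edge 0)" "p 0 \<in> \<Inter>(edge 1)"
        using pq[of 0] ps[of 0] by simp_all
      ultimately have "L 0 = L 1"
        unfolding L_def
        using dual_label_pow_eq_if_two_zeros[OF simplex simplex] zero that by metis
      then show False using L_neq[of 0] by simp
    qed
    have p_in: "p i \<in> \<Inter>(edge i)" "p i \<in> \<Inter>(edge (Suc i))" for i
      using pq[of i] ps[of i] by simp_all
    \<comment> \<open>\<open>p 1\<close> lies on edges 1 and 2, \<open>p 3\<close> on edges 3 and 4,
      and each pair carries both labels.\<close>
    have p: "p 1 = p 0" "p 3 = p 0"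
      using common[of "p 1" 2 1] common[of "p 3" 4 3] p_in[of 1] p_in[of 3] L02
      by (simp_all add: numeral_eq_Suc)
    have E: "\<Inter>(edge 0) = closed_segment (p 0) (q 0)" "\<Inter>(edge 2) = closed_segment (p 0) (s 1)"
        "\<Inter>(edge 4) = closed_segment (p 0) (s 3)"
      using pq[of 0] ps[of 1] ps[of 3] p by (simp_all add: numeral_eq_Suc)
    have ne: "p 0 \<noteq> q 0" "p 0 \<noteq> s 1" "p 0 \<noteq> s 3"
      using simplex[of 0] simplex[of 2] simplex[of 4] unfolding E by auto
    \<comment> \<open>Here \<open>5 \<le> n\<close> enters: indices 0 to 4 name different triangles,
      so edges 0, 2 and 4 are three different segments. They leave \<open>p 0\<close> along one
      line, which is impossible.\<close>
    have "T 0 \<noteq> T 2" "T 1 \<noteq> T 2" "T 0 \<noteq> T 4" "T 1 \<noteq> T 4" "T 2 \<noteq> T 4" "T 3 \<noteq> T 4"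
      using 3 by (simp_all add: T_eq)
    then have "\<Inter>(edge 0) \<noteq> \<Inter>(edge 2)" "\<Inter>(edge 0) \<noteq> \<Inter>(edge 4)" "\<Inter>(edge 2) \<noteq> \<Inter>(edge 4)"
      using edges_neq[of 0 2] edges_neq[of 0 4] edges_neq[of 2 4] by (simp_all add: numeral_eq_Suc)
    moreover have "q 0 \<in> \<Inter>(edge 0)" "s 1 \<in> \<Inter>(edge 2)" "s 3 \<in> \<Inter>(edge 4)"
      unfolding E by simp_all
    then have "eval_at (edge_form (edge 0)) (q 0) = 0" "eval_at (edge_form (edge 0)) (s 1) = 0"
        "eval_at (edge_form (edge 0)) (s 3) = 0"
      using zero L02 by blast+
    then have "closed_segment (p 0) (q 0) = closed_segment (p 0) (s 1) \<or>
        closed_segment (p 0) (q 0) = closed_segment (p 0) (s 3) \<or>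
        closed_segment (p 0) (s 1) = closed_segment (p 0) (s 3)"
      using form[of 0] zero[OF p_in(1)[of 0] refl] ne E_in[of 0] E_in[of 2] E_in[of 4]
      unfolding E vanishing_form_def
      by (intro collinear_edges_at_vertex[OF \<Delta>, of _ _ _ _ "edge_form (edge 0)"]) auto
    ultimately show ?thesis unfolding E by blast
  qed
qed

end
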